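(* The set $\mathcal H=\{(a,b)\in\mathbb R/\mathbb Z\times[0,1): f_{a,b}\text{ has an attracting cycle}\}$ is open in $\mathbb T\times[0,1]$.
   Context: Let $\mathbb T=\mathbb R/\mathbb Z$, identified with $[0,1]$ with $0\sim 1$. For $(a,b)\in\mathbb R/\mathbb Z\times[0,1]$ define $f_{a,b}:\mathbb T\to\mathbb T$ by $f_{a,b}(x)=\left(2x+a+\frac b2 S(x)\right)\bmod 1$, where $S(x)=4x-1$ for $x\in[0,\frac12]$ and $S(x)=-4x+3$ for $x\in[\frac12,1)$. A periodic cycle of exact period $p$ is attracting if each of its points has a neighbourhood all of whose points converge to it under iteration of $f_{a,b}^p$. *)

theory Defs
  imports "HOL-Analysis.Analysis"
begin

quotient_type circle = real / "\<lambda>x y::real. x - y \<in> \<int>"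
  morphisms rep_circle to_circle
proof (intro equivpI)
  show "reflp (\<lambda>x y::real. x - y \<in> \<int>)"
    by (simp add: reflp_def)
  show "symp (\<lambda>x y::real. x - y \<in> \<int>)"
    unfolding symp_def by (metis Ints_minus minus_diff_eq)
  show "transp (\<lambda>x y::real. x - y \<in> \<int>)"
    unfolding transp_def by (metis Ints_add diff_add_cancel add_diff_eq)
qed

text \<open>The circle carries the quotient topology of the real line.\<close>

instantiation circle :: topological_space
begin

definition open_circle :: "circle set \<Rightarrow> bool" where
  "open_circle U \<longleftrightarrow> open (to_circle -` U)"

instance
proof
  show "open (UNIV :: circle set)"
    by (simp add: open_circle_def)
  show "open (U \<inter> V)" if "open U" "open V" for U V :: "circle set"
    using that by (simp add: open_circle_def open_Int)
  show "open (\<Union>K)" if "\<forall>U\<in>K. open U" for K :: "circle set set"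
    using that by (simp add: open_circle_def vimage_Union open_UN)
qed

end

text \<open>The function \<open>S_fun\<close> is only meaningful on \<open>[0,1)\<close>; it is evaluated below at the
  representative \<open>frac x\<close> of the point \<open>x\<close>.\<close>

definition S_fun :: "real \<Rightarrow> real" where
  "S_fun x = (if x \<le> 1/2 then 4 * x - 1 else - 4 * x + 3)"

lift_definition f_map :: "circle \<Rightarrow> real \<Rightarrow> circle \<Rightarrow> circle"
  is "\<lambda>a b x. 2 * x + a + b / 2 * S_fun (frac x)"
proof -
  fix a a' b x x' :: real
  assume a: "a - a' \<in> \<int>" and x: "x - x' \<in> \<int>"
  from x have "frac x = frac x'"
    by (auto simp: frac_def elim!: Ints_cases simp: diff_eq_eq)
  moreover have "2 * (x - x') + (a - a') \<in> \<int>"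
    using a x by (intro Ints_add Ints_mult) auto
  ultimately show "(2 * x + a + b / 2 * S_fun (frac x)) - (2 * x' + a' + b / 2 * S_fun (frac x')) \<in> \<int>"
    by (simp add: algebra_simps)
qed

definition periodic_cycle :: "('a \<Rightarrow> 'a) \<Rightarrow> nat \<Rightarrow> 'a set \<Rightarrow> bool" where
  "periodic_cycle g p C \<longleftrightarrow> p > 0 \<and>
     (\<exists>x. (g ^^ p) x = x \<and> (\<forall>k. 0 < k \<and> k < p \<longrightarrow> (g ^^ k) x \<noteq> x) \<and>
          C = (\<lambda>k. (g ^^ k) x) ` {..<p})"

definition attracting_cycle :: "('a::topological_space \<Rightarrow> 'a) \<Rightarrow> nat \<Rightarrow> 'a set \<Rightarrow> bool" where
  "attracting_cycle g p C \<longleftrightarrow> periodic_cycle g p C \<and>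
     (\<forall>x\<in>C. \<exists>U. open U \<and> x \<in> U \<and> (\<forall>y\<in>U. (\<lambda>n. ((g ^^ p) ^^ n) y) \<longlonglongrightarrow> x))"

definition attracting_params :: "(circle \<times> real) set" where
  "attracting_params = {(a, b). 0 \<le> b \<and> b < 1 \<and> (\<exists>p C. attracting_cycle (f_map a b) p C)}"

end

theory Submission
  imports Defs
begin

text \<open>
  For \<open>0 \<le> b < 1\<close> the map \<open>f_map a b\<close> is an orientation preserving covering of degree two.
  It is piecewise affine with slopes \<open>2 + 2 * b\<close> and \<open>2 - 2 * b\<close>, and it breaks at
  \<open>0\<close> and \<open>1/2\<close>. Let \<open>F\<close> be its increasing lift to the line.

  An attracting point of period \<open>p\<close> lifts to a fixed point \<open>x\<close> of \<open>G y = F\<^sup>p y - k\<close> for an integer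
  \<open>k\<close>. Close to \<open>x\<close>, the map \<open>G\<close> moves points towards \<open>x\<close> from both sides
  (\<open>attracted_right\<close>, \<open>attracted_left\<close>). Hence some interval \<open>[\<alpha>, \<beta>]\<close> is mapped strictly into
  itself, with \<open>G \<alpha> > \<alpha>\<close> and \<open>G \<beta> < \<beta>\<close>, and this survives small changes of the
  parameters. The perturbed \<open>G\<close> therefore goes from above to below the diagonal somewhere in
  \<open>[\<alpha>, \<beta>]\<close>.

  A crossing point of a piecewise affine map is attracting as soon as both one-sided slopes are
  smaller than \<open>1\<close>; the only obstruction is a slope equal to \<open>1\<close>, where \<open>G\<close> may be the
  identity on a whole interval, whose points are not attracting. Attraction at the unperturbed
  parameters does not exclude such slopes. For a cycle through both \<open>0\<close> and \<open>1/2\<close>, the one-sided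
  slopes of \<open>F\<^sup>p\<close> contain the factor \<open>(2 + 2 * b) * (2 - 2 * b)\<close>, whereas arbitrarily close
  parameters have short arcs where it is replaced by \<open>(2 + 2 * b)\<^sup>2\<close>. There are two cases.
  \<^item> If \<open>b'\<close> differs from \<open>b\<close> and is close to it, no slope of the \<open>p\<close>-th iterate equals \<open>1\<close>, because the
    slopes are values at \<open>b'\<close> of finitely many polynomials, none of which is the constant \<open>1\<close>
    (\<open>finite_neutral_slopes\<close>).
  \<^item> If \<open>b' = b\<close> and \<open>a'\<close> differs from \<open>a\<close> and is close to it, then neither \<open>0\<close> nor \<open>1/2\<close> is
    fixed by the \<open>p\<close>-th iterate, because \<open>F\<^sup>p 0\<close> and \<open>F\<^sup>p (1/2)\<close> increase strictly with \<open>a'\<close>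
    (\<open>finite_periodic_params\<close>). The orbits of fixed points of \<open>G\<close> thus avoid the breaks, the two
    one-sided slopes agree, and at a crossing from above to below they are smaller than \<open>1\<close>.

  The remaining parameter \<open>(a, b)\<close> itself has an attracting cycle by assumption.
\<close>

section \<open>Attracting periodic points of continuous maps\<close>

lemma LIMSEQ_residue_classes:
  fixes X :: "nat \<Rightarrow> 'a::topological_space"
  assumes "r > 0" and "\<And>s. s < r \<Longrightarrow> (\<lambda>m. X (r * m + s)) \<longlonglongrightarrow> l"
  shows "X \<longlonglongrightarrow> l"
proof (rule topological_tendstoI)
  fix V assume V: "open V" "l \<in> V"
  have "\<forall>\<^sub>F m in sequentially. \<forall>s\<in>{..<r}. X (r * m + s) \<in> V"
    using assms(2) V by (intro eventually_ball_finite) (auto dest: topological_tendstoD)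
  then obtain N where N: "\<And>m s. m \<ge> N \<Longrightarrow> s < r \<Longrightarrow> X (r * m + s) \<in> V"
    by (auto simp: eventually_sequentially)
  have "X n \<in> V" if "n \<ge> r * N" for n
  proof -
    have "n div r \<ge> N"
      using that \<open>r > 0\<close> by (simp add: less_eq_div_iff_mult_less_eq mult.commute)
    from N[OF this, of "n mod r"] show ?thesis
      using \<open>r > 0\<close> by simp
  qed
  then show "\<forall>\<^sub>F n in sequentially. X n \<in> V"
    by (auto simp: eventually_sequentially)
qed

lemma continuous_on_funpow:
  fixes f :: "'a::topological_space \<Rightarrow> 'a"
  assumes "continuous_on UNIV f"
  shows "continuous_on UNIV (f ^^ n)"
proof (induction n)
  case (Suc n)
  then show ?case
    using continuous_on_compose[of UNIV "f ^^ n" f] assms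
    by (auto intro: continuous_on_subset)
qed (simp add: id_def)

text \<open>
  The period \<open>p\<close> need not be exact. The exact period \<open>q\<close> divides it. In each
  residue class modulo \<open>p div q\<close>, the iterates of \<open>f ^^ q\<close> are iterates of \<open>f ^^ p\<close> followed by a
  fixed number of steps of \<open>f ^^ q\<close>, so convergence under \<open>f ^^ p\<close> gives convergence under \<open>f ^^ q\<close>. The other points of the cycle inherit a basin as
  preimages of \<open>U\<close>.
\<close>

lemma attracting_cycle_if_attracting_point:
  fixes f :: "'a::topological_space \<Rightarrow> 'a"
  assumes cont: "continuous_on UNIV f" and "p > 0" and x: "(f ^^ p) x = x"
    and U: "open U" "x \<in> U" "\<And>y. y \<in> U \<Longrightarrow> (\<lambda>n. ((f ^^ p) ^^ n) y) \<longlonglongrightarrow> x"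
  shows "\<exists>q C. attracting_cycle f q C"
proof -
  define q where "q = (LEAST q. q > 0 \<and> (f ^^ q) x = x)"
  have q: "q > 0" "(f ^^ q) x = x"
    using LeastI[of "\<lambda>q. q > 0 \<and> (f ^^ q) x = x" p] \<open>p > 0\<close> x by (auto simp: q_def)
  have qmin: "(f ^^ k) x \<noteq> x" if "0 < k" "k < q" for k
    using not_less_Least[of k "\<lambda>q. q > 0 \<and> (f ^^ q) x = x"] that by (auto simp: q_def)
  have qn: "(f ^^ (q * n)) x = x" for n
    by (induction n) (auto simp: funpow_add q)
  have "(f ^^ (p mod q)) x = x"
  proof -
    have "(f ^^ p) x = (f ^^ (p mod q + q * (p div q))) x" by simp
    also have "\<dots> = (f ^^ (p mod q)) x" by (simp only: funpow_add o_apply qn)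
    finally show ?thesis using x by simp
  qed
  then have "p mod q = 0"
    using qmin[of "p mod q"] q(1) by fastforce
  then obtain r where r: "p = q * r" by auto
  then have "r > 0" using \<open>p > 0\<close> by auto
  then have "q \<le> p" using r by simp
  have attr: "\<exists>V. open V \<and> (f ^^ i) x \<in> V \<and> (\<forall>y\<in>V. (\<lambda>n. ((f ^^ q) ^^ n) y) \<longlonglongrightarrow> (f ^^ i) x)"
    if "i < q" for i
  proof (intro exI conjI ballI)
    have "i \<le> p" using that \<open>q \<le> p\<close> by simp
    show "open ((f ^^ (p - i)) -` U)"
      using continuous_on_funpow[OF cont] U(1) by (simp add: continuous_on_open_vimage)
    have "(f ^^ (p - i)) ((f ^^ i) x) = (f ^^ (p - i + i)) x"
      by (simp only: funpow_add o_apply)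
    then show "(f ^^ i) x \<in> (f ^^ (p - i)) -` U"
      using \<open>i \<le> p\<close> x U(2) by simp
    fix y assume y: "y \<in> (f ^^ (p - i)) -` U"
    show "(\<lambda>n. ((f ^^ q) ^^ n) y) \<longlonglongrightarrow> (f ^^ i) x"
    proof (rule LIMSEQ_residue_classes[OF \<open>r > 0\<close>])
      fix s
      \<comment> \<open>An orbit that starts near \<open>f\<^sup>i x\<close> first needs \<open>p - i\<close> steps to reach \<open>U\<close>; this delay is why
        the limit is computed along \<open>Suc m\<close>.\<close>
      have lim: "(\<lambda>m. (f ^^ (i + q * s)) (((f ^^ p) ^^ m) ((f ^^ (p - i)) y)))
              \<longlonglongrightarrow> (f ^^ (i + q * s)) x"
        using U(3)[of "(f ^^ (p - i)) y"] y
        by (intro continuous_on_tendsto_compose[OF continuous_on_funpow[OF cont]]) auto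
      have eq: "(f ^^ (i + q * s)) (((f ^^ p) ^^ m) ((f ^^ (p - i)) y))
              = ((f ^^ q) ^^ (r * Suc m + s)) y" for m
      proof -
        have "i + q * s + p * m + (p - i) = q * (r * Suc m + s)"
          using \<open>i \<le> p\<close> r by (simp add: algebra_simps)
        moreover have "(f ^^ (i + q * s)) (((f ^^ p) ^^ m) ((f ^^ (p - i)) y))
              = (f ^^ (i + q * s + p * m + (p - i))) y"
          by (simp only: funpow_add o_apply funpow_mult)
        ultimately show ?thesis by (simp add: funpow_mult)
      qed
      have "(f ^^ (i + q * s)) x = (f ^^ i) x"
        by (simp add: funpow_add qn)
      with lim eq have "(\<lambda>m. ((f ^^ q) ^^ (r * Suc m + s)) y) \<longlonglongrightarrow> (f ^^ i) x"
        by simp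
      then show "(\<lambda>m. ((f ^^ q) ^^ (r * m + s)) y) \<longlonglongrightarrow> (f ^^ i) x"
        by (subst (asm) filterlim_sequentially_Suc[of "\<lambda>m. ((f ^^ q) ^^ (r * m + s)) y"])
    qed
  qed
  have "attracting_cycle f q ((\<lambda>k. (f ^^ k) x) ` {..<q})"
    unfolding attracting_cycle_def periodic_cycle_def using q qmin attr by blast
  then show ?thesis by blast
qed

section \<open>The circle and its covering by the line\<close>

lemma to_circle_eq_iff: "to_circle x = to_circle y \<longleftrightarrow> x - y \<in> \<int>"
  by (rule circle.abs_eq_iff)

lemma to_circle_surj: "\<exists>x. to_circle x = c"
  by (metis Quotient_abs_rep Quotient_circle)

lemma continuous_on_to_circle: "continuous_on UNIV to_circle"
  by (simp add: continuous_on_open_vimage open_circle_def)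

lemma open_to_circle_image:
  assumes "open U" shows "open (to_circle ` U)"
proof -
  have "to_circle -` (to_circle ` U) = (\<Union>m::int. (\<lambda>x. of_int m + x) ` U)"
  proof (intro set_eqI iffI)
    fix x assume "x \<in> to_circle -` (to_circle ` U)"
    then obtain y where "y \<in> U" "x - y \<in> \<int>" by (auto simp: to_circle_eq_iff)
    then obtain m :: int where "x = of_int m + y" by (auto elim!: Ints_cases simp: algebra_simps)
    with \<open>y \<in> U\<close> show "x \<in> (\<Union>m::int. (\<lambda>x. of_int m + x) ` U)" by auto
  next
    fix x assume "x \<in> (\<Union>m::int. (\<lambda>x. of_int m + x) ` U)"
    then obtain m y where y: "y \<in> U" and "x = of_int m + y" by auto
    then have "to_circle x = to_circle y" by (simp add: to_circle_eq_iff)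
    with y show "x \<in> to_circle -` (to_circle ` U)" by auto
  qed
  moreover have "open \<dots>"
    using assms by (intro open_UN ballI open_translation)
  ultimately show ?thesis by (simp add: open_circle_def)
qed

lemma cis_eq_iff_Ints: "cis (2 * pi * x) = cis (2 * pi * y) \<longleftrightarrow> x - y \<in> \<int>"
proof
  assume "cis (2 * pi * x) = cis (2 * pi * y)"
  then have "sin (2 * pi * x) = sin (2 * pi * y) \<and> cos (2 * pi * x) = cos (2 * pi * y)"
    by (simp add: complex_eq_iff)
  then obtain n :: int where "2 * pi * x = 2 * pi * y + 2 * pi * n"
    using sin_cos_eq_iff by blast
  then have "2 * pi * (x - y) = 2 * pi * n" by (simp add: algebra_simps)
  then show "x - y \<in> \<int>" by simp
next
  assume "x - y \<in> \<int>"
  then obtain n :: int where "x - y = n" by (auto elim: Ints_cases)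
  then have x: "x = y + n" by simp
  have "cis (2 * pi * x) = cis (2 * pi * y) * cis (2 * pi * n)"
    by (simp only: x cis_mult distrib_left)
  then show "cis (2 * pi * x) = cis (2 * pi * y)"
    by simp
qed

text \<open>
  A continuous injection of the circle into the plane. It turns convergence on the circle into
  convergence of complex numbers, where limits are unique.
\<close>

lift_definition circle_cis :: "circle \<Rightarrow> complex" is "\<lambda>x. cis (2 * pi * x)"
  by (simp add: cis_eq_iff_Ints)

lemma continuous_on_circle_cis: "continuous_on UNIV circle_cis"
proof -
  have "to_circle -` (circle_cis -` V) = (\<lambda>x. cis (2 * pi * x)) -` V" for V
    by (auto simp: circle_cis.abs_eq)
  moreover have "open ((\<lambda>x::real. cis (2 * pi * x)) -` V)" if "open V" for V
    using that by (intro open_vimage continuous_intros)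
  ultimately show ?thesis
    by (simp add: continuous_on_open_vimage open_circle_def)
qed

lemma tendsto_to_circle_imp_cis:
  assumes "(\<lambda>n. to_circle (X n)) \<longlonglongrightarrow> to_circle x"
  shows "(\<lambda>n. cis (2 * pi * X n)) \<longlonglongrightarrow> cis (2 * pi * x)"
  using continuous_on_tendsto_compose[OF continuous_on_circle_cis assms]
  by (simp add: circle_cis.abs_eq)

section \<open>An attracting point of a covering map is trapped on both sides\<close>

lemma funpow_translate:
  fixes G :: "real \<Rightarrow> real" and D :: int
  assumes "\<And>y m. G (y + of_int m) = G y + of_int (D * m)"
  shows "(G ^^ n) (y + of_int m) = (G ^^ n) y + of_int (D ^ n * m)"
proof (induction n)
  case (Suc n)
  then show ?case using assms[of "(G ^^ n) y" "D ^ n * m"] by (simp add: mult.assoc)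
qed simp

text \<open>
  Attraction only says that nearby orbits converge to \<open>x\<close> on the circle; such an orbit might leave
  \<open>x\<close> on one side and return from the other after travelling around. The degree \<open>D\<close> excludes this.
  If \<open>w \<le> G w\<close>, the orbit of \<open>w\<close> increases. When it never passes \<open>x + 1\<close>, it converges to
  a fixed point of \<open>G\<close> in \<open>(x, x + 1]\<close>; this is not \<open>x + 1\<close>, which \<open>G\<close> sends to \<open>x + D\<close>, and so it
  is another point of the circle. When it passes \<open>x + 1\<close>, some
  iterate of \<open>[x, w]\<close> covers \<open>[x, x + 1]\<close>, and so contains a point \<open>z\<close> with \<open>G (G z) = z + 1\<close>. On the
  circle this point has period two under \<open>G\<close> and never converges to \<open>x\<close>.
\<close>

lemma attracted_right:
  fixes G :: "real \<Rightarrow> real" and D :: int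
  assumes cont: "continuous_on UNIV G" and mono: "mono G" and "D \<ge> 2"
    and deg: "\<And>y m. G (y + of_int m) = G y + of_int (D * m)"
    and fix_x: "G x = x" and "x < w"
    and conv: "\<And>y. x \<le> y \<Longrightarrow> y \<le> w \<Longrightarrow> (\<lambda>n. cis (2 * pi * (G ^^ n) y)) \<longlonglongrightarrow> cis (2 * pi * x)"
  shows "G w < w"
proof (rule ccontr)
  assume "\<not> G w < w"
  then have w: "w \<le> G w" by simp
  have inc: "incseq (\<lambda>n. (G ^^ n) w)"
  proof (rule incseq_SucI)
    show "(G ^^ n) w \<le> (G ^^ Suc n) w" for n
      by (induction n) (auto simp: w intro: monoD[OF mono])
  qed
  have Dx: "G (x + 1) = x + D"
    using deg[of x 1] fix_x by simp
  show False
  proof (cases "\<forall>n. (G ^^ n) w \<le> x + 1")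
    case True
    then obtain L where L: "(\<lambda>n. (G ^^ n) w) \<longlonglongrightarrow> L"
      using incseq_convergent[OF inc, of "x + 1"] by metis
    have "w \<le> L"
      using incseq_le[OF inc L, of 0] by simp
    have "L \<le> x + 1"
      using L True by (intro LIMSEQ_le_const2) auto
    have "(\<lambda>n. G ((G ^^ n) w)) \<longlonglongrightarrow> G L"
      by (rule continuous_on_tendsto_compose[OF cont L]) auto
    moreover have "(\<lambda>n. G ((G ^^ n) w)) \<longlonglongrightarrow> L"
      using LIMSEQ_Suc[OF L] by simp
    ultimately have "G L = L" by (rule LIMSEQ_unique)
    have "(\<lambda>n. cis (2 * pi * (G ^^ n) w)) \<longlonglongrightarrow> cis (2 * pi * L)"
      using L by (intro tendsto_intros)
    with conv[of w] have "cis (2 * pi * L) = cis (2 * pi * x)"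
      using \<open>x < w\<close> LIMSEQ_unique by auto
    then obtain m :: int where "L - x = m" by (auto simp: cis_eq_iff_Ints elim: Ints_cases)
    with \<open>x < w\<close> \<open>w \<le> L\<close> \<open>L \<le> x + 1\<close> have "0 < real_of_int m" "real_of_int m \<le> 1" by linarith+
    then have "m = 1" by linarith
    then have "L = x + 1" using \<open>L - x = m\<close> by simp
    then show False using Dx \<open>G L = L\<close> \<open>D \<ge> 2\<close> by simp
  next
    case False
    then obtain n where n: "(G ^^ n) w > x + 1" by (meson not_le)
    have contn: "continuous_on UNIV (G ^^ k)" for k
      by (rule continuous_on_funpow[OF cont])
    have "D * D \<ge> 2 * 2"
      using \<open>D \<ge> 2\<close> by (intro mult_mono) auto
    then have "real_of_int (D * D) \<ge> 4" by linarith
    have G2: "(G ^^ 2) (x + 1) = x + of_int (D * D)"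
      using deg[of x D] Dx fix_x by (simp add: numeral_2_eq_2)
    \<comment> \<open>The displacement of \<open>G\<^sup>2\<close> is \<open>0\<close> at \<open>x\<close> and \<open>D\<^sup>2 - 1 \<ge> 3\<close> at \<open>x + 1\<close>. For \<open>D = 2\<close> the
      displacement of \<open>G\<close> itself is \<open>1\<close> at \<open>x + 1\<close>, and the point found could be \<open>x + 1\<close>.\<close>
    have "\<exists>z. x \<le> z \<and> z \<le> x + 1 \<and> (G ^^ 2) z - z = 1"
      using G2 fix_x \<open>real_of_int (D * D) \<ge> 4\<close>
      by (intro IVT' continuous_intros continuous_on_subset[OF contn])
         (auto simp: numeral_2_eq_2)
    then obtain z where z: "x \<le> z" "z \<le> x + 1" "(G ^^ 2) z = z + 1"
      by (auto simp: algebra_simps)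
    have "z \<noteq> x" using z fix_x by (auto simp: numeral_2_eq_2)
    moreover have "z \<noteq> x + 1"
      using z(3) G2 \<open>real_of_int (D * D) \<ge> 4\<close> by auto
    ultimately have "0 < z - x" "z - x < 1" using z by auto
    then have "z - x \<notin> \<int>"
      by (auto elim!: Ints_cases)
    have fixn: "(G ^^ n) x = x" by (induction n) (auto simp: fix_x)
    have "\<exists>y. x \<le> y \<and> y \<le> w \<and> (G ^^ n) y = z"
      using fixn z n \<open>x < w\<close> by (intro IVT' continuous_on_subset[OF contn]) auto
    then obtain y where y: "x \<le> y" "y \<le> w" "(G ^^ n) y = z" by blast
    have orb: "\<exists>m::int. (G ^^ (2 * j)) z = z + of_int m" for j
    proof (induction j)
      case (Suc j)
      then obtain m :: int where m: "(G ^^ (2 * j)) z = z + of_int m" by blast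
      have "(G ^^ (2 * Suc j)) z = (G ^^ 2) ((G ^^ (2 * j)) z)"
        by (simp add: funpow_add numeral_2_eq_2)
      also have "\<dots> = z + of_int (1 + D ^ 2 * m)"
        unfolding m using funpow_translate[of G D 2 z m, OF deg] z(3) by simp
      finally show ?case by blast
    qed (auto intro: exI[of _ 0])
    have "(\<lambda>j. cis (2 * pi * (G ^^ (2 * j + n)) y)) \<longlonglongrightarrow> cis (2 * pi * x)"
      using LIMSEQ_subseq_LIMSEQ[OF conv[OF y(1,2)], of "\<lambda>j. 2 * j + n"]
      by (simp add: strict_mono_def o_def)
    moreover have "cis (2 * pi * (G ^^ (2 * j + n)) y) = cis (2 * pi * z)" for j
    proof -
      have "(G ^^ (2 * j + n)) y - z \<in> \<int>"
        using orb[of j] y(3) by (auto simp: funpow_add)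
      then show ?thesis by (simp add: cis_eq_iff_Ints)
    qed
    ultimately have "cis (2 * pi * z) = cis (2 * pi * x)"
      by (simp add: LIMSEQ_const_iff)
    with \<open>z - x \<notin> \<int>\<close> show False by (simp add: cis_eq_iff_Ints)
  qed
qed

text \<open>Conjugation by \<open>y \<mapsto> - y\<close> exchanges the two sides.\<close>

lemma attracted_left:
  fixes G :: "real \<Rightarrow> real" and D :: int
  assumes cont: "continuous_on UNIV G" and mono: "mono G" and "D \<ge> 2"
    and deg: "\<And>y m. G (y + of_int m) = G y + of_int (D * m)"
    and "G x = x" and "w < x"
    and conv: "\<And>y. w \<le> y \<Longrightarrow> y \<le> x \<Longrightarrow> (\<lambda>n. cis (2 * pi * (G ^^ n) y)) \<longlonglongrightarrow> cis (2 * pi * x)"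
  shows "w < G w"
proof -
  define H where "H y = - G (- y)" for y
  have Hn: "(H ^^ n) y = - (G ^^ n) (- y)" for n y
    by (induction n) (auto simp: H_def)
  have "H (- w) < - w"
  proof (rule attracted_right[where D = D])
    show "continuous_on UNIV H"
      unfolding H_def
      by (intro continuous_intros continuous_on_compose2[OF cont]) auto
    show "mono H"
      using mono by (auto simp: H_def mono_def)
    show "H (y + of_int m) = H y + of_int (D * m)" for y m
      using deg[of "- y" "- m"] by (simp add: H_def)
    show "(\<lambda>n. cis (2 * pi * (H ^^ n) y)) \<longlonglongrightarrow> cis (2 * pi * (- x))"
      if "- x \<le> y" "y \<le> - w" for y
      using tendsto_cnj[OF conv[of "- y"]] that by (simp add: Hn cis_cnj)
  qed (use assms in \<open>auto simp: H_def\<close>)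
  then show ?thesis by (simp add: H_def)
qed

section \<open>Affine germs and attracting fixed points\<close>

text \<open>
  The set \<open>K\<close> of admissible displacements is a half line or \<open>UNIV\<close>, so that one-sided and two-sided
  germs are handled at once.
\<close>

definition affine_germ :: "real set \<Rightarrow> (real \<Rightarrow> real) \<Rightarrow> real \<Rightarrow> real \<Rightarrow> bool" where
  "affine_germ K f x c \<longleftrightarrow> (\<exists>e>0. \<forall>t\<in>K. \<bar>t\<bar> < e \<longrightarrow> f (x + t) = f x + c * t)"

lemma affine_germ_subset: "affine_germ K f x c \<Longrightarrow> L \<subseteq> K \<Longrightarrow> affine_germ L f x c"
  unfolding affine_germ_def by blast

lemma affine_germ_compose:
  assumes f: "affine_germ K f x c" and g: "affine_germ K g (f x) d" and "c > 0"
    and cone: "\<And>t r. t \<in> K \<Longrightarrow> r > 0 \<Longrightarrow> r * t \<in> K"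
  shows "affine_germ K (g \<circ> f) x (d * c)"
proof -
  from f obtain e where e: "e > 0" "\<And>t. t \<in> K \<Longrightarrow> \<bar>t\<bar> < e \<Longrightarrow> f (x + t) = f x + c * t"
    unfolding affine_germ_def by blast
  from g obtain e' where e': "e' > 0" "\<And>t. t \<in> K \<Longrightarrow> \<bar>t\<bar> < e' \<Longrightarrow> g (f x + t) = g (f x) + d * t"
    unfolding affine_germ_def by blast
  have "(g \<circ> f) (x + t) = (g \<circ> f) x + d * c * t" if "t \<in> K" "\<bar>t\<bar> < min e (e' / c)" for t
  proof -
    have "\<bar>c * t\<bar> < e'" using that \<open>c > 0\<close> by (simp add: abs_mult field_simps)
    with that e(2)[of t] e'(2)[of "c * t"] cone[of t c] \<open>c > 0\<close> show ?thesis by simp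
  qed
  moreover have "min e (e' / c) > 0" using e e' \<open>c > 0\<close> by simp
  ultimately show ?thesis unfolding affine_germ_def by blast
qed

text \<open>
  The supremum \<open>u\<close> of the points above the diagonal is fixed. It is a limit from the left of points
  above the diagonal, which forces \<open>l < 1\<close>, and there are none to its right, which forces
  \<open>r \<le> 1\<close>. The last alternative in the hypothesis excludes \<open>r = 1\<close>.
\<close>

lemma attracting_fixed_point_between:
  fixes g :: "real \<Rightarrow> real"
  assumes "\<alpha> < \<beta>" and cont: "continuous_on UNIV g" and "\<alpha> < g \<alpha>" "g \<beta> < \<beta>"
    and germs: "\<And>u. g u = u \<Longrightarrow> \<exists>l r. 0 \<le> l \<and> 0 \<le> r \<and> affine_germ {..0} g u l \<and> affine_germ {0..} g u r
                     \<and> (r \<noteq> 1 \<or> l = r)"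
  obtains u c e where "g u = u" "0 \<le> c" "c < 1" "e > 0"
    "\<And>y. \<bar>y - u\<bar> < e \<Longrightarrow> \<bar>g y - u\<bar> \<le> c * \<bar>y - u\<bar>"
proof -
  define E where "E = {y \<in> {\<alpha>..\<beta>}. y < g y}"
  define u where "u = Sup E"
  have "\<alpha> \<in> E" using assms by (auto simp: E_def)
  have bdd: "bdd_above E" by (auto simp: E_def intro!: bdd_aboveI[of _ \<beta>])
  have E_le: "y \<le> u" if "y \<in> E" for y
    unfolding u_def using that bdd by (rule cSup_upper)
  have "closed {y \<in> {\<alpha>..\<beta>}. y \<le> g y}"
    by (intro continuous_on_closed_Collect_le continuous_on_subset[OF cont] continuous_intros) auto
  moreover have "E \<subseteq> {y \<in> {\<alpha>..\<beta>}. y \<le> g y}" "E \<noteq> {}"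
    using \<open>\<alpha> \<in> E\<close> by (auto simp: E_def)
  ultimately have "u \<in> {y \<in> {\<alpha>..\<beta>}. y \<le> g y}"
    unfolding u_def using closed_subset_contains_Sup bdd by blast
  then have u: "\<alpha> \<le> u" "u \<le> \<beta>" "u \<le> g u" by auto
  then have "u < \<beta>" using \<open>g \<beta> < \<beta>\<close> by (cases "u = \<beta>") auto
  have gu: "g u = u"
  proof (rule ccontr)
    assume "g u \<noteq> u"
    with u have "0 < g u - u" by simp
    moreover have "((\<lambda>y. g y - y) \<longlongrightarrow> g u - u) (at_right u)"
      using cont by (intro tendsto_intros)
        (auto simp: continuous_on_eq_continuous_at isCont_def intro: tendsto_within_subset)
    ultimately have "\<forall>\<^sub>F y in at_right u. 0 < g y - y"
      by (metis order_tendstoD(1))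
    moreover have "\<forall>\<^sub>F y in at_right u. y \<in> {u<..<\<beta>}"
      using \<open>u < \<beta>\<close> by (rule eventually_at_right_real)
    ultimately have "\<forall>\<^sub>F y in at_right u. 0 < g y - y \<and> y \<in> {u<..<\<beta>}"
      by eventually_elim auto
    then obtain y where "0 < g y - y" "y \<in> {u<..<\<beta>}"
      by (metis (no_types, lifting) eventually_happens trivial_limit_at_right_real)
    then show False using E_le[of y] u by (auto simp: E_def)
  qed
  then obtain l r where lr: "0 \<le> l" "0 \<le> r" "affine_germ {..0} g u l" "affine_germ {0..} g u r"
    "r \<noteq> 1 \<or> l = r" using germs by blast
  from lr(3) obtain el where el: "el > 0" "\<And>t. t \<le> 0 \<Longrightarrow> \<bar>t\<bar> < el \<Longrightarrow> g (u + t) = u + l * t"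
    unfolding affine_germ_def by (auto simp: gu)
  from lr(4) obtain er where er: "er > 0" "\<And>t. t \<ge> 0 \<Longrightarrow> \<bar>t\<bar> < er \<Longrightarrow> g (u + t) = u + r * t"
    unfolding affine_germ_def by (auto simp: gu)
  have "l < 1"
  proof -
    obtain y where y: "y \<in> E" "u - el < y"
      using less_cSup_iff[of E "u - el"] \<open>\<alpha> \<in> E\<close> bdd el(1) unfolding u_def by auto
    then have "y \<noteq> u" using gu by (auto simp: E_def)
    with y E_le have "y < u" by force
    with y el(2)[of "y - u"] have "g y = u + l * (y - u)" by simp
    then have "(1 - l) * (u - y) > 0" using y by (auto simp: E_def algebra_simps)
    then show ?thesis using \<open>y < u\<close> by (simp add: zero_less_mult_iff)
  qed
  have "r \<le> 1"
  proof -
    define t where "t = min (er / 2) (\<beta> - u)"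
    have t: "t > 0" "t < er" "u + t \<le> \<beta>" using er(1) \<open>u < \<beta>\<close> by (auto simp: t_def min_def)
    then have "u + t \<notin> E" using E_le[of "u + t"] by auto
    then have "g (u + t) \<le> u + t" using t u by (auto simp: E_def)
    then have "r * t \<le> 1 * t" using er(2)[of t] t by simp
    then show ?thesis using t by simp
  qed
  have "r < 1" using \<open>r \<le> 1\<close> \<open>l < 1\<close> lr(5) by auto
  show ?thesis
  proof (rule that[of u "max l r" "min el er"])
    fix y assume y: "\<bar>y - u\<bar> < min el er"
    show "\<bar>g y - u\<bar> \<le> max l r * \<bar>y - u\<bar>"
    proof (cases "y \<le> u")
      case True
      then have "\<bar>g y - u\<bar> = l * \<bar>y - u\<bar>" using el(2)[of "y - u"] y lr by (simp add: abs_mult)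
      then show ?thesis by (simp add: mult_right_mono)
    next
      case False
      then have "\<bar>g y - u\<bar> = r * \<bar>y - u\<bar>" using er(2)[of "y - u"] y lr by (simp add: abs_mult)
      then show ?thesis by (simp add: mult_right_mono)
    qed
  qed (use gu lr \<open>l < 1\<close> \<open>r < 1\<close> el er in auto)
qed

lemma tendsto_of_contraction:
  fixes g :: "real \<Rightarrow> real"
  assumes "0 \<le> c" "c < 1" and "\<And>y. \<bar>y - u\<bar> < e \<Longrightarrow> \<bar>g y - u\<bar> \<le> c * \<bar>y - u\<bar>"
    and y: "\<bar>y - u\<bar> < e"
  shows "(\<lambda>n. (g ^^ n) y) \<longlonglongrightarrow> u"
proof -
  have bnd: "\<bar>(g ^^ n) y - u\<bar> \<le> c ^ n * \<bar>y - u\<bar>" for n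
  proof (induction n)
    case (Suc n)
    have "c ^ n * \<bar>y - u\<bar> \<le> 1 * \<bar>y - u\<bar>"
      using assms by (intro mult_right_mono power_le_one) auto
    with Suc y have "\<bar>(g ^^ n) y - u\<bar> < e" by simp
    then have "\<bar>g ((g ^^ n) y) - u\<bar> \<le> c * \<bar>(g ^^ n) y - u\<bar>" by (rule assms(3))
    also have "\<dots> \<le> c * (c ^ n * \<bar>y - u\<bar>)" using Suc assms by (intro mult_left_mono)
    finally show ?case by simp
  qed simp
  have "(\<lambda>n. c ^ n * \<bar>y - u\<bar>) \<longlonglongrightarrow> 0"
    using assms by (intro tendsto_mult_left_zero LIMSEQ_power_zero) auto
  then have "(\<lambda>n. (g ^^ n) y - u) \<longlonglongrightarrow> 0"
    by (rule Lim_null_comparison[rotated]) (use bnd in auto)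
  then show ?thesis by (rule LIM_zero_cancel)
qed

section \<open>The lifted family\<close>

text \<open>The \<open>1\<close>-periodic zigzag with slopes \<open>4\<close> and \<open>-4\<close> that extends \<open>S_fun\<close> to the line.\<close>

definition tent :: "real \<Rightarrow> real" where
  "tent x = S_fun (frac x)"

definition lift_map :: "real \<Rightarrow> real \<Rightarrow> real \<Rightarrow> real" where
  "lift_map A b x = 2 * x + A + b / 2 * tent x"

lemma f_map_to_circle: "f_map (to_circle A) b (to_circle x) = to_circle (lift_map A b x)"
  by (simp add: f_map.abs_eq lift_map_def tent_def)

lemma tent_eq: "tent x = 1 - 4 * \<bar>frac x - 1 / 2\<bar>"
  by (simp add: tent_def S_fun_def abs_if)

lemma tent_add_int [simp]: "tent (x + of_int m) = tent x"
  by (simp add: tent_def frac_def)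

lemma tent_minus: "tent (- x) = tent x"
proof (cases "x \<in> \<int>")
  case True
  then have "- x \<in> \<int>" by simp
  with True have "frac x = 0" "frac (- x) = 0" by (simp_all only: frac_eq_0_iff)
  then show ?thesis by (simp only: tent_eq)
next
  case False
  then show ?thesis by (simp add: tent_eq frac_neg)
qed

text \<open>
  The value \<open>tent x\<close> is \<open>1\<close> minus four times the distance of \<open>x\<close> to the set \<open>1/2 + \<int>\<close>, and a
  distance function is \<open>1\<close>-Lipschitz.
\<close>

lemma tent_lipschitz: "\<bar>tent x - tent y\<bar> \<le> 4 * \<bar>x - y\<bar>"
proof -
  have *: "\<bar>frac y - 1 / 2\<bar> \<le> \<bar>frac x - 1 / 2\<bar> + \<bar>x - y\<bar>" for x y :: real
  proof -
    have "\<bar>frac y - 1 / 2\<bar> \<le> \<bar>y - (of_int \<lfloor>x\<rfloor> + 1 / 2)\<bar>"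
    proof -
      consider "\<lfloor>y\<rfloor> = \<lfloor>x\<rfloor>" | "\<lfloor>y\<rfloor> + 1 \<le> \<lfloor>x\<rfloor>" | "\<lfloor>x\<rfloor> + 1 \<le> \<lfloor>y\<rfloor>" by linarith
      then show ?thesis
        by cases (unfold frac_def, simp, linarith+)
    qed
    then show ?thesis unfolding frac_def by linarith
  qed
  define u v where "u = \<bar>frac x - 1 / 2\<bar>" and "v = \<bar>frac y - 1 / 2\<bar>"
  have "\<bar>v - u\<bar> \<le> \<bar>x - y\<bar>"
    using *[where x = x and y = y] *[where x = y and y = x]
    unfolding u_def[symmetric] v_def[symmetric] by linarith
  moreover have "tent x - tent y = 4 * (v - u)" by (simp add: tent_eq u_def v_def)
  then have "\<bar>tent x - tent y\<bar> = 4 * \<bar>v - u\<bar>" by (simp only: abs_mult abs_numeral)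
  ultimately show ?thesis by simp
qed

lemma continuous_on_tent: "continuous_on S tent"
proof -
  have "4-lipschitz_on S tent"
    by (rule lipschitz_onI) (auto simp: dist_real_def tent_lipschitz)
  then show ?thesis by (rule lipschitz_on_continuous_on)
qed

lemma tent_germ_right: "\<exists>s\<in>{4, -4}. affine_germ {0..} tent x s"
proof (cases "frac x < 1 / 2")
  case True
  have "tent (x + t) = tent x + 4 * t" if "0 \<le> t" "t < 1 / 2 - frac x" for t
  proof -
    have "frac (x + t) = frac x + t" using that frac_ge_0[of x]
      by (intro iffD2[OF frac_unique_iff]) (auto simp: frac_def)
    then show ?thesis using that True by (auto simp: tent_def S_fun_def)
  qed
  then have "affine_germ {0..} tent x 4" using True
    unfolding affine_germ_def by (intro exI[of _ "1 / 2 - frac x"]) auto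
  then show ?thesis by blast
next
  case False
  have "tent (x + t) = tent x + (-4) * t" if "0 \<le> t" "t < 1 - frac x" for t
  proof -
    have "frac (x + t) = frac x + t" using that frac_ge_0[of x]
      by (intro iffD2[OF frac_unique_iff]) (auto simp: frac_def)
    then show ?thesis using that False by (auto simp: tent_def S_fun_def)
  qed
  then have "affine_germ {0..} tent x (-4)" using frac_lt_1[of x]
    unfolding affine_germ_def by (intro exI[of _ "1 - frac x"]) auto
  then show ?thesis by blast
qed

lemma tent_germ_left: "\<exists>s\<in>{4, -4}. affine_germ {..0} tent x s"
proof -
  obtain s where s: "s \<in> {4, -4}" "affine_germ {0..} tent (- x) s"
    using tent_germ_right by blast
  from s(2) obtain e where e: "e > 0" "\<And>t. t \<ge> 0 \<Longrightarrow> \<bar>t\<bar> < e \<Longrightarrow> tent (- x + t) = tent (- x) + s * t"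
    unfolding affine_germ_def by auto
  have "tent (x + t) = tent x + (- s) * t" if "t \<le> 0" "\<bar>t\<bar> < e" for t
    using e(2)[of "- t"] that tent_minus[of x] tent_minus[of "x + t"] by simp
  then have "affine_germ {..0} tent x (- s)"
    unfolding affine_germ_def using e(1) by auto
  then show ?thesis using s(1) by auto
qed

lemma tent_germ_both:
  assumes "2 * x \<notin> \<int>"
  shows "\<exists>s\<in>{4, -4}. affine_germ UNIV tent x s"
proof (cases "frac x < 1 / 2")
  case True
  have "frac x \<noteq> 0"
    using assms by (auto simp: frac_eq_0_iff)
  then have "frac x > 0" using frac_ge_0[of x] by linarith
  have "tent (x + t) = tent x + 4 * t" if "\<bar>t\<bar> < min (frac x) (1 / 2 - frac x)" for t
  proof -
    have "frac (x + t) = frac x + t" using that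
      by (intro iffD2[OF frac_unique_iff]) (auto simp: frac_def)
    then show ?thesis using that True by (auto simp: tent_def S_fun_def)
  qed
  then have "affine_germ UNIV tent x 4" using True \<open>frac x > 0\<close>
    unfolding affine_germ_def by (intro exI[of _ "min (frac x) (1 / 2 - frac x)"]) auto
  then show ?thesis by blast
next
  case False
  have "frac x \<noteq> 1 / 2"
  proof
    assume "frac x = 1 / 2"
    then have "2 * x = of_int (2 * \<lfloor>x\<rfloor> + 1)" by (simp add: frac_def)
    with assms show False by (metis Ints_of_int)
  qed
  then have "frac x > 1 / 2" using False by linarith
  have "tent (x + t) = tent x + (-4) * t" if "\<bar>t\<bar> < min (frac x - 1 / 2) (1 - frac x)" for t
  proof -
    have "frac (x + t) = frac x + t" using that \<open>frac x > 1 / 2\<close>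
      by (intro iffD2[OF frac_unique_iff]) (auto simp: frac_def)
    then show ?thesis using that \<open>frac x > 1 / 2\<close> by (auto simp: tent_def S_fun_def)
  qed
  then have "affine_germ UNIV tent x (-4)" using \<open>frac x > 1 / 2\<close> frac_lt_1[of x]
    unfolding affine_germ_def by (intro exI[of _ "min (frac x - 1 / 2) (1 - frac x)"]) auto
  then show ?thesis by blast
qed

text \<open>The term with \<open>b\<close> is \<open>2 * b\<close>-Lipschitz, so the term \<open>2 * x\<close> dominates it.\<close>

lemma lift_map_strict_mono:
  assumes "0 \<le> b" "b < 1"
  shows "strict_mono (lift_map A b)"
proof (rule strict_monoI)
  fix x y :: real assume "x < y"
  have "b / 2 * (tent x - tent y) \<le> b / 2 * (4 * (y - x))"
    using assms tent_lipschitz[of x y] \<open>x < y\<close> by (intro mult_left_mono) auto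
  also have "\<dots> = b * (2 * (y - x))" by simp
  also have "\<dots> < 1 * (2 * (y - x))"
    using assms \<open>x < y\<close> by (intro mult_strict_right_mono) auto
  finally show "lift_map A b x < lift_map A b y"
    by (simp add: lift_map_def algebra_simps diff_divide_distrib)
qed

lemma lift_map_mono:
  assumes "0 \<le> b" "b < 1"
  shows "mono (lift_map A b ^^ n)"
  using strict_mono_mono[OF lift_map_strict_mono[OF assms, of A]]
  by (induction n) (auto simp: mono_def)

lemma lift_map_add_int: "lift_map A b (x + of_int m) = lift_map A b x + of_int (2 * m)"
  by (simp add: lift_map_def)

lemmas lift_map_iter_add_int = funpow_translate[of "lift_map A b" 2 for A b, OF lift_map_add_int]

lemma continuous_on_lift_map: "continuous_on UNIV (lift_map A b)"
  unfolding lift_map_def by (intro continuous_intros continuous_on_tent)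

lemma continuous_on_lift_map_params:
  "continuous_on UNIV (\<lambda>(A, b). (lift_map A b ^^ n) x)"
proof (induction n)
  case 0
  then show ?case by (simp add: case_prod_unfold)
next
  case (Suc n)
  then show ?case
    unfolding case_prod_unfold funpow.simps o_apply lift_map_def[of "fst _"]
    by (intro continuous_intros continuous_on_compose2[OF continuous_on_tent[of UNIV]]) auto
qed

lemma lift_map_iter_strict_mono_param:
  assumes "0 \<le> b" "b < 1" "A < A'" "n > 0"
  shows "(lift_map A b ^^ n) x < (lift_map A' b ^^ n) x"
  using \<open>n > 0\<close>
proof (induction n rule: nat_induct_non_zero)
  case 1
  then show ?case using assms by (simp add: lift_map_def)
next
  case (Suc n)
  have "lift_map A b ((lift_map A b ^^ n) x) < lift_map A b ((lift_map A' b ^^ n) x)"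
    using Suc lift_map_strict_mono[OF assms(1,2)] by (simp add: strict_mono_less)
  also have "\<dots> < lift_map A' b ((lift_map A' b ^^ n) x)"
    using assms by (simp add: lift_map_def)
  finally show ?case by simp
qed

text \<open>
  The exponent \<open>i\<close> counts the visits of the orbit to the branch of slope \<open>2 + 2 * b\<close>. Slopes are
  positive, so each step maps the side of the point given by \<open>K\<close> to the same side of its image.
\<close>

lemma lift_map_iter_germ:
  assumes "0 \<le> b" "b < 1" and cone: "\<And>t r. t \<in> K \<Longrightarrow> r > 0 \<Longrightarrow> r * t \<in> K"
    and "\<And>j. j < n \<Longrightarrow> \<exists>s\<in>{4, -4}. affine_germ K tent ((lift_map A b ^^ j) x) s"
  shows "\<exists>i\<le>n. affine_germ K (lift_map A b ^^ n) x ((2 + 2 * b) ^ i * (2 - 2 * b) ^ (n - i))"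
  using assms(4)
proof (induction n)
  case 0
  then show ?case by (auto simp: affine_germ_def intro: exI[of _ 1])
next
  case (Suc n)
  obtain i where i: "i \<le> n"
    "affine_germ K (lift_map A b ^^ n) x ((2 + 2 * b) ^ i * (2 - 2 * b) ^ (n - i))"
    using Suc by force
  obtain s where s: "s \<in> {4, -4}" "affine_germ K tent ((lift_map A b ^^ n) x) s"
    using Suc.prems by blast
  have "affine_germ K (lift_map A b) ((lift_map A b ^^ n) x) (2 + b / 2 * s)"
    using s(2) unfolding affine_germ_def lift_map_def by (auto simp: algebra_simps)
  moreover have "(2 + 2 * b) ^ i * (2 - 2 * b) ^ (n - i) > 0"
    using assms by simp
  ultimately have germ: "affine_germ K (lift_map A b ^^ Suc n) x
      ((2 + b / 2 * s) * ((2 + 2 * b) ^ i * (2 - 2 * b) ^ (n - i)))"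
    using affine_germ_compose[OF i(2)] cone by simp
  show ?case
  proof (cases "s = 4")
    case True
    then show ?thesis using germ i(1) by (intro exI[of _ "Suc i"]) (auto simp: algebra_simps o_def)
  next
    case False
    then have "s = -4" using s by auto
    then show ?thesis using germ i(1)
      by (intro exI[of _ i]) (auto simp: algebra_simps Suc_diff_le o_def)
  qed
qed

section \<open>Exceptional parameters\<close>

text \<open>
  For each \<open>i\<close> the product is a polynomial in \<open>b\<close> whose value at \<open>b = 0\<close> is \<open>2 ^ p \<noteq> 1\<close>.
\<close>

lemma finite_neutral_slopes:
  assumes "p > 0"
  shows "finite {b::real. \<exists>i\<le>p. (2 + 2 * b) ^ i * (2 - 2 * b) ^ (p - i) = 1}"
proof -
  have "finite {b::real. (2 + 2 * b) ^ i * (2 - 2 * b) ^ (p - i) = 1}" if "i \<le> p" for i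
  proof -
    define P :: "real poly" where "P = [:2, 2:] ^ i * [:2, -2:] ^ (p - i) - 1"
    have P: "poly P b = (2 + 2 * b) ^ i * (2 - 2 * b) ^ (p - i) - 1" for b
      by (simp add: P_def algebra_simps)
    have "poly P 0 = 2 ^ p - 1"
      using that by (simp add: P flip: power_add)
    then have "P \<noteq> 0" using one_less_power[of "2::real" p] assms by fastforce
    then have "finite {b. poly P b = 0}" by (rule poly_roots_finite)
    then show ?thesis by (simp add: P)
  qed
  then have "finite (\<Union>i\<in>{..p}. {b::real. (2 + 2 * b) ^ i * (2 - 2 * b) ^ (p - i) = 1})"
    by auto
  moreover have "(\<Union>i\<in>{..p}. {b::real. (2 + 2 * b) ^ i * (2 - 2 * b) ^ (p - i) = 1})
     = {b::real. \<exists>i\<le>p. (2 + 2 * b) ^ i * (2 - 2 * b) ^ (p - i) = 1}" by auto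
  ultimately show ?thesis by simp
qed

text \<open>
  As \<open>A\<close> increases, \<open>F\<^sup>p q\<close> increases strictly; over a bounded range of \<open>A\<close> it stays bounded, and so
  meets finitely many translates of \<open>q\<close>, each of them at most once.
\<close>

lemma finite_periodic_params:
  assumes "0 \<le> b" "b < 1" "p > 0"
  shows "finite {A. \<bar>A - A0\<bar> \<le> 1 \<and> (lift_map A b ^^ p) q - q \<in> \<int>}"
proof (rule finite_imageD)
  let ?f = "\<lambda>A. (lift_map A b ^^ p) q - q"
  have less: "?f A < ?f A'" if "A < A'" for A A'
    using lift_map_iter_strict_mono_param[OF assms(1,2) that assms(3)] by simp
  show "inj_on ?f {A. \<bar>A - A0\<bar> \<le> 1 \<and> ?f A \<in> \<int>}"
    by (rule inj_onI) (metis less less_irrefl linorder_neqE)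
  have "?f ` {A. \<bar>A - A0\<bar> \<le> 1 \<and> ?f A \<in> \<int>} \<subseteq> {k \<in> \<int>. ?f (A0 - 1) \<le> k \<and> k \<le> ?f (A0 + 1)}"
  proof clarify
    fix A assume "\<bar>A - A0\<bar> \<le> 1"
    then have "A0 - 1 \<le> A" "A \<le> A0 + 1" by auto
    then show "?f (A0 - 1) \<le> ?f A \<and> ?f A \<le> ?f (A0 + 1)"
      using less[of "A0 - 1" A] less[of A "A0 + 1"] by (auto simp: le_less)
  qed
  moreover have "finite {k \<in> \<int>. ?f (A0 - 1) \<le> k \<and> k \<le> ?f (A0 + 1)}"
    by (rule finite_int_segment)
  ultimately show "finite (?f ` {A. \<bar>A - A0\<bar> \<le> 1 \<and> ?f A \<in> \<int>})"
    by (rule finite_subset)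
qed

text \<open>
  If the orbit of a periodic point hits a break, the break is itself periodic. The integer by which
  \<open>F\<^sup>p\<close> displaces it can be a different one, since the degree of \<open>F\<close> is two; this is why all integers are
  allowed as displacements here and in \<open>finite_periodic_params\<close>.
\<close>

lemma periodic_break_point:
  assumes per: "(lift_map A b ^^ p) u - u \<in> \<int>" and br: "2 * (lift_map A b ^^ j) u \<in> \<int>"
  shows "\<exists>q\<in>{0, 1/2}. (lift_map A b ^^ p) q - q \<in> \<int>"
proof -
  let ?F = "lift_map A b"
  obtain k :: int where k: "(?F ^^ p) u = u + of_int k"
    using per by (auto elim!: Ints_cases simp: algebra_simps)
  define v where "v = (?F ^^ j) u"
  have "(?F ^^ p) v = (?F ^^ j) ((?F ^^ p) u)"
    unfolding v_def by (metis add.commute funpow_add o_apply)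
  also have "\<dots> = v + of_int (2 ^ j * k)"
    unfolding k lift_map_iter_add_int v_def by simp
  finally have v: "(?F ^^ p) v - v \<in> \<int>" by simp
  obtain m :: int where m: "2 * v = of_int m" using br by (auto simp: v_def elim!: Ints_cases)
  have "\<exists>q\<in>{0, 1/2}. \<exists>n::int. v = q + of_int n"
  proof (cases "even m")
    case True
    then show ?thesis using m by (auto elim!: evenE)
  next
    case False
    then obtain n where "m = 2 * n + 1" by (rule oddE)
    then have "v = 1 / 2 + of_int n" using m by simp
    then show ?thesis by blast
  qed
  then obtain q n where q: "q \<in> {0, 1/2}" "v = q + of_int n" by blast
  have "(?F ^^ p) q - q = (?F ^^ p) v - v + of_int (n - 2 ^ p * n)"
    unfolding q(2) lift_map_iter_add_int by simp
  also have "\<dots> \<in> \<int>" using v by (intro Ints_add) auto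
  finally show ?thesis using q(1) by blast
qed

section \<open>Attracting cycles and trapping intervals\<close>

lemma f_map_iter_to_circle:
  "(f_map (to_circle A) b ^^ n) (to_circle x) = to_circle ((lift_map A b ^^ n) x)"
  by (induction n) (auto simp: f_map_to_circle)

lemma f_map_iter_shift:
  "((f_map (to_circle A) b ^^ p) ^^ n) (to_circle x)
     = to_circle (((\<lambda>y. (lift_map A b ^^ p) y - of_int k) ^^ n) x)"
proof (induction n)
  case (Suc n)
  have "to_circle (y - of_int k) = to_circle y" for y
    by (simp add: to_circle_eq_iff)
  with Suc show ?case by (simp add: f_map_iter_to_circle)
qed simp

lemma continuous_on_f_map: "continuous_on UNIV (f_map a b)"
proof -
  obtain A where a: "a = to_circle A" using to_circle_surj by metis
  have "to_circle -` (f_map a b -` V) = lift_map A b -` (to_circle -` V)" for V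
    by (auto simp: a f_map_to_circle)
  then show ?thesis
    using continuous_on_lift_map[of A b]
    by (simp add: continuous_on_open_vimage open_circle_def)
qed

lemma trapping_interval:
  assumes b: "0 \<le> b" "b < 1" and "attracting_cycle (f_map (to_circle A) b) p C"
  obtains \<alpha> \<beta> k where "p > 0" "\<alpha> < \<beta>" "\<alpha> < (lift_map A b ^^ p) \<alpha> - of_int k"
    "(lift_map A b ^^ p) \<beta> - of_int k < \<beta>"
proof -
  let ?f = "f_map (to_circle A) b"
  from assms(3) obtain c where p: "p > 0" and c: "(?f ^^ p) c = c" and "c \<in> C"
    unfolding attracting_cycle_def periodic_cycle_def by force
  then obtain U where U: "open U" "c \<in> U" "\<And>y. y \<in> U \<Longrightarrow> (\<lambda>n. ((?f ^^ p) ^^ n) y) \<longlonglongrightarrow> c"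
    using assms(3) unfolding attracting_cycle_def by meson
  obtain x where x: "c = to_circle x" using to_circle_surj by metis
  have "to_circle ((lift_map A b ^^ p) x) = to_circle x"
    using c by (simp add: x f_map_iter_to_circle)
  then obtain k :: int where k: "(lift_map A b ^^ p) x - x = of_int k"
    by (auto simp: to_circle_eq_iff elim: Ints_cases)
  define G where "G = (\<lambda>y. (lift_map A b ^^ p) y - of_int k)"
  have "open (to_circle -` U)" using U(1) by (simp add: open_circle_def)
  then obtain e where e: "e > 0" "cball x e \<subseteq> to_circle -` U"
    using U(2) x open_contains_cball by blast
  have conv: "(\<lambda>n. cis (2 * pi * (G ^^ n) y)) \<longlonglongrightarrow> cis (2 * pi * x)" if "\<bar>y - x\<bar> \<le> e" for y
  proof (rule tendsto_to_circle_imp_cis)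
    have "y \<in> cball x e" using that by (simp add: dist_real_def abs_minus_commute)
    then have "to_circle y \<in> U" using e(2) by blast
    then show "(\<lambda>n. to_circle ((G ^^ n) y)) \<longlonglongrightarrow> to_circle x"
      using U(3)[of "to_circle y"] by (simp add: f_map_iter_shift[where k = k] x G_def)
  qed
  have cont: "continuous_on UNIV G"
    unfolding G_def by (intro continuous_intros continuous_on_funpow continuous_on_lift_map)
  have mono: "mono G"
    using lift_map_mono[OF b, where A = A and n = p] by (auto simp: G_def mono_def)
  have deg: "G (y + of_int m) = G y + of_int (2 ^ p * m)" for y m
    by (simp add: G_def lift_map_iter_add_int)
  have D: "(2::int) ^ p \<ge> 2" using p by (simp add: self_le_power)
  have fix_x: "G x = x" using k by (simp add: G_def)
  have "G (x + e) < x + e"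
    by (rule attracted_right[OF cont mono D deg fix_x]) (use e(1) conv in auto)
  moreover have "x - e < G (x - e)"
    by (rule attracted_left[OF cont mono D deg fix_x]) (use e(1) conv in auto)
  ultimately show ?thesis
    using that[of "x - e" "x + e" k] p e(1) by (simp add: G_def)
qed

text \<open>
  In the first alternative of \<open>nondeg\<close> the right slope at a fixed point is never \<open>1\<close>; in the second the
  orbit of a fixed point avoids the breaks, so the two one-sided slopes agree. Either one is enough
  for \<open>attracting_fixed_point_between\<close>.
\<close>

lemma attracting_cycle_if_trapping_interval:
  assumes b: "0 \<le> b" "b < 1" and "p > 0" and "\<alpha> < \<beta>"
    and "\<alpha> < (lift_map A b ^^ p) \<alpha> - of_int k" "(lift_map A b ^^ p) \<beta> - of_int k < \<beta>"
    and nondeg: "(\<forall>i\<le>p. (2 + 2 * b) ^ i * (2 - 2 * b) ^ (p - i) \<noteq> 1)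
      \<or> (\<forall>q\<in>{0, 1/2}. (lift_map A b ^^ p) q - q \<notin> \<int>)"
  shows "\<exists>q C. attracting_cycle (f_map (to_circle A) b) q C"
proof -
  define G where "G = (\<lambda>y. (lift_map A b ^^ p) y - of_int k)"
  define slope where "slope i = (2 + 2 * b) ^ i * (2 - 2 * b) ^ (p - i)" for i
  have slope: "slope i \<ge> 0" for i using b by (simp add: slope_def)
  have shift: "affine_germ K G u c" if "affine_germ K (lift_map A b ^^ p) u c" for K u c
    using that unfolding affine_germ_def G_def by (auto simp: algebra_simps)
  have cont: "continuous_on UNIV G"
    unfolding G_def by (intro continuous_intros continuous_on_funpow continuous_on_lift_map)
  have germs: "\<exists>l r. 0 \<le> l \<and> 0 \<le> r \<and> affine_germ {..0} G u l \<and> affine_germ {0..} G u r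
                     \<and> (r \<noteq> 1 \<or> l = r)" if u: "G u = u" for u
    using nondeg
  proof
    assume ne: "\<forall>i\<le>p. (2 + 2 * b) ^ i * (2 - 2 * b) ^ (p - i) \<noteq> 1"
    obtain i where "affine_germ {..0} (lift_map A b ^^ p) u (slope i)"
      using lift_map_iter_germ[OF b, of "{..0}" p A u] tent_germ_left
      by (auto simp: slope_def mult_nonneg_nonpos)
    moreover obtain j where "j \<le> p" "affine_germ {0..} (lift_map A b ^^ p) u (slope j)"
      using lift_map_iter_germ[OF b, of "{0..}" p A u] tent_germ_right
      by (auto simp: slope_def)
    ultimately show ?thesis
      using slope shift ne unfolding slope_def by blast
  next
    assume nb: "\<forall>q\<in>{0, 1/2}. (lift_map A b ^^ p) q - q \<notin> \<int>"
    have "(lift_map A b ^^ p) u - u = of_int k" using u by (simp add: G_def)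
    then have "(lift_map A b ^^ p) u - u \<in> \<int>" by simp
    then have "2 * (lift_map A b ^^ j) u \<notin> \<int>" for j
      using periodic_break_point nb by blast
    then obtain i where "affine_germ UNIV (lift_map A b ^^ p) u (slope i)"
      using lift_map_iter_germ[OF b, of UNIV p A u] tent_germ_both by (auto simp: slope_def)
    then have "affine_germ UNIV G u (slope i)" by (rule shift)
    then show ?thesis using slope[of i] affine_germ_subset by blast
  qed
  obtain u c e where u: "G u = u" and c: "0 \<le> c" "c < 1" and e: "e > 0"
    and contr: "\<And>y. \<bar>y - u\<bar> < e \<Longrightarrow> \<bar>G y - u\<bar> \<le> c * \<bar>y - u\<bar>"
    using attracting_fixed_point_between[OF \<open>\<alpha> < \<beta>\<close> cont _ _ germs] assms(5,6)
    unfolding G_def by metis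
  show ?thesis
  proof (rule attracting_cycle_if_attracting_point[OF continuous_on_f_map \<open>p > 0\<close>])
    show "(f_map (to_circle A) b ^^ p) (to_circle u) = to_circle u"
      using f_map_iter_shift[where A = A and b = b and p = p and n = 1 and x = u and k = k] u by (simp add: G_def)
    show "open (to_circle ` ball u e)" by (rule open_to_circle_image) simp
    show "to_circle u \<in> to_circle ` ball u e" using e by simp
    fix z assume "z \<in> to_circle ` ball u e"
    then obtain y where y: "z = to_circle y" "\<bar>y - u\<bar> < e"
      by (auto simp: dist_real_def abs_minus_commute)
    have "(\<lambda>n. (G ^^ n) y) \<longlonglongrightarrow> u"
      by (rule tendsto_of_contraction[OF c contr y(2)])
    then have "(\<lambda>n. to_circle ((G ^^ n) y)) \<longlonglongrightarrow> to_circle u"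
      by (rule continuous_on_tendsto_compose[OF continuous_on_to_circle]) auto
    then show "(\<lambda>n. ((f_map (to_circle A) b ^^ p) ^^ n) z) \<longlonglongrightarrow> to_circle u"
      by (simp add: y(1) f_map_iter_shift[where k = k] G_def)
  qed
qed

section \<open>Openness\<close>

text \<open>
  The radius \<open>d\<close> keeps the interval trapping (\<open>dA\<close>, \<open>dB\<close>) and keeps away from the exceptional
  parameters other than \<open>A\<close> and \<open>b\<close> themselves (\<open>d1\<close>, \<open>d2\<close>); the bound \<open>1\<close> is the range in which
  the exceptional values of \<open>A\<close> are known to be finite in number.
\<close>

lemma attracting_cycle_nearby:
  assumes b: "0 \<le> b" "b < 1" and attr: "attracting_cycle (f_map (to_circle A) b) p C"
  obtains d where "d > 0"
    "\<And>A' b'. \<bar>A' - A\<bar> < d \<Longrightarrow> \<bar>b' - b\<bar> < d \<Longrightarrow> 0 \<le> b' \<Longrightarrow> b' < 1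
       \<Longrightarrow> \<exists>q C. attracting_cycle (f_map (to_circle A') b') q C"
proof -
  obtain \<alpha> \<beta> k where p: "p > 0" and "\<alpha> < \<beta>"
    and trap: "\<alpha> < (lift_map A b ^^ p) \<alpha> - of_int k" "(lift_map A b ^^ p) \<beta> - of_int k < \<beta>"
    using trapping_interval[OF b attr] by blast
  define T where "T = {z. \<alpha> < (case z of (A, b) \<Rightarrow> (lift_map A b ^^ p) \<alpha>) - of_int k
                      \<and> (case z of (A, b) \<Rightarrow> (lift_map A b ^^ p) \<beta>) - of_int k < \<beta>}"
  have "open T"
    unfolding T_def
    by (intro open_Collect_conj open_Collect_less continuous_intros continuous_on_lift_map_params)
  moreover have "(A, b) \<in> T" using trap by (simp add: T_def)
  ultimately obtain V W where VW: "open V" "open W" "A \<in> V" "b \<in> W" "V \<times> W \<subseteq> T"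
    by (elim open_prod_elim) auto
  obtain dA where dA: "dA > 0" "ball A dA \<subseteq> V" using VW open_contains_ball by blast
  obtain dB where dB: "dB > 0" "ball b dB \<subseteq> W" using VW open_contains_ball by blast
  define per where "per A' \<longleftrightarrow> (\<exists>q\<in>{0, 1/2}. (lift_map A' b ^^ p) q - q \<in> \<int>)" for A'
  have "{A'. \<bar>A' - A\<bar> \<le> 1 \<and> per A'}
      = (\<Union>q\<in>{0, 1/2}. {A'. \<bar>A' - A\<bar> \<le> 1 \<and> (lift_map A' b ^^ p) q - q \<in> \<int>})"
    unfolding per_def by blast
  then have "finite {A'. \<bar>A' - A\<bar> \<le> 1 \<and> per A'}"
    by (simp only: finite_Un finite_UN finite.intros ball_simps finite_periodic_params[OF b p])
  then obtain d1 where d1: "d1 > 0"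
    "\<And>A'. \<bar>A' - A\<bar> \<le> 1 \<Longrightarrow> per A' \<Longrightarrow> A' \<noteq> A \<Longrightarrow> d1 \<le> dist A A'"
    using finite_set_avoid[of "{A'. \<bar>A' - A\<bar> \<le> 1 \<and> per A'}" A] by auto
  obtain d2 where d2: "d2 > 0"
    "\<And>b' i. i \<le> p \<Longrightarrow> (2 + 2 * b') ^ i * (2 - 2 * b') ^ (p - i) = 1 \<Longrightarrow> b' \<noteq> b \<Longrightarrow> d2 \<le> dist b b'"
    using finite_set_avoid[OF finite_neutral_slopes[OF p], of b] by blast
  define d where "d = Min {dA, dB, d1, d2, 1}"
  have "d > 0" using dA dB d1 d2 by (simp add: d_def)
  have d: "d \<le> dA" "d \<le> dB" "d \<le> d1" "d \<le> d2" "d \<le> 1" by (auto simp: d_def)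
  show ?thesis
  proof (rule that[OF \<open>d > 0\<close>])
    fix A' b' assume A': "\<bar>A' - A\<bar> < d" and b': "\<bar>b' - b\<bar> < d" "0 \<le> b'" "b' < 1"
    show "\<exists>q C. attracting_cycle (f_map (to_circle A') b') q C"
    proof (cases "A' = A \<and> b' = b")
      case True
      then show ?thesis using attr by blast
    next
      case False
      have "A' \<in> V" "b' \<in> W"
        using A' b' d dA(2) dB(2) by (auto simp: subset_iff dist_real_def abs_minus_commute)
      with VW have "(A', b') \<in> T" by blast
      then have T: "\<alpha> < (lift_map A' b' ^^ p) \<alpha> - of_int k" "(lift_map A' b' ^^ p) \<beta> - of_int k < \<beta>"
        by (auto simp: T_def)
      have "(\<forall>i\<le>p. (2 + 2 * b') ^ i * (2 - 2 * b') ^ (p - i) \<noteq> 1)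
          \<or> (\<forall>q\<in>{0, 1/2}. (lift_map A' b' ^^ p) q - q \<notin> \<int>)"
      proof (cases "b' = b")
        case True
        with False have "A' \<noteq> A" by blast
        then have "\<not> per A'"
          using d1(2)[of A'] A' d by (auto simp: dist_real_def abs_minus_commute)
        then show ?thesis using True by (auto simp: per_def)
      next
        case False
        then show ?thesis
          using d2(2)[of _ b'] b' d by (force simp: dist_real_def abs_minus_commute)
      qed
      then show ?thesis
        by (rule attracting_cycle_if_trapping_interval[OF b'(2,3) p \<open>\<alpha> < \<beta>\<close> T])
    qed
  qed
qed

theorem proposition3p1:
  "openin (top_of_set ((UNIV :: circle set) \<times> {0..1::real})) attracting_params"
proof (subst openin_subopen, intro ballI)
  fix z assume "z \<in> attracting_params"
  then obtain a b p C where z: "z = (a, b)" and b: "0 \<le> b" "b < 1"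
    and attr: "attracting_cycle (f_map a b) p C"
    by (auto simp: attracting_params_def)
  obtain A where a: "a = to_circle A" using to_circle_surj by metis
  obtain d where d: "d > 0"
    "\<And>A' b'. \<bar>A' - A\<bar> < d \<Longrightarrow> \<bar>b' - b\<bar> < d \<Longrightarrow> 0 \<le> b' \<Longrightarrow> b' < 1
       \<Longrightarrow> \<exists>q C. attracting_cycle (f_map (to_circle A') b') q C"
    using attracting_cycle_nearby[OF b] attr a by metis
  define N where "N = to_circle ` ball A d \<times> (ball b d \<inter> {..<1})"
  have "open N"
    unfolding N_def by (intro open_Times open_to_circle_image open_Int) auto
  then have "openin (top_of_set (UNIV \<times> {0..1})) ((UNIV \<times> {0..1}) \<inter> N)"
    by (rule openin_open_Int)
  moreover have "z \<in> (UNIV \<times> {0..1}) \<inter> N"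
    using b d(1) by (auto simp: z a N_def)
  moreover have "(UNIV \<times> {0..1}) \<inter> N \<subseteq> attracting_params"
    using d(2) by (auto simp: N_def attracting_params_def dist_real_def abs_minus_commute)
  ultimately show "\<exists>T. openin (top_of_set (UNIV \<times> {0..1})) T \<and> z \<in> T \<and> T \<subseteq> attracting_params"
    by blast
qed

end
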